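(* Let $\mathcal{B}$ be the set of all blocking games, and let $\mathcal{P}(\mathcal{B})$ be the set of strictly $\mathscr{P}$-free elements of $\mathcal{B}$. Then $\mathcal{P}(\mathcal{B})$ is closed under disjunctive sum. Consequently, the set $\mathcal{P}_{\mathcal{B}}(\mathcal{B})$ of elements of $\mathcal{B}$ that are $\mathscr{P}$-free modulo $\mathcal{B}$ is also closed under disjunctive sum.
   Context: Games are short combinatorial game forms (no tombstones here) played under the misère convention: a player unable to move wins. The outcome $o(G)\in\{\mathscr{L},\mathscr{N},\mathscr{P},\mathscr{R}\}$: $\mathscr{L}$ if Left wins whoever starts, $\mathscr{R}$ if Right wins whoever starts, $\mathscr{N}$ if the first player wins, $\mathscr{P}$ if the second player wins. $G+H$ is the disjunctive sum. A subposition of $G$ is any game reachable from $G$ by a possibly empty, not necessarily alternating, sequence of moves (so $G$ is a subposition of itself). A game is strictly $\mathscr{P}$-free if none of its subpositions has outcome $\mathscr{P}$. For a set $\mathcal{A}$ of games, $G\geq_{\mathcal{A}}H$ means $o(G+X)\geq o(H+X)$ for all $X\in\mathcal{A}$ (outcomes ordered by $\mathscr{L}>\mathscr{N}>\mathscr{R}$, $\mathscr{L}>\mathscr{P}>\mathscr{R}$, with $\mathscr{N},\mathscr{P}$ incomparable), and $G\equiv_{\mathcal{A}}H$ means both $G\geq_{\mathcal{A}}H$ and $H\geq_{\mathcal{A}}G$. $\mathcal{P}_{\mathcal{A}}(\mathcal{A})$ is the set of $G\in\mathcal{A}$ for which there is a strictly $\mathscr{P}$-free $H\in\mathcal{A}$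 with $G\equiv_{\mathcal{A}}H$. A Left end is a game with no Left options (Right end symmetric). A Left end $X$ is blocked if for every Right option $X^R$ of $X$, either $X^R$ is a blocked Left end, or there is a Left option $X^{RL}$ of $X^R$ that is a blocked Left end; blocked Right ends are defined symmetrically. A game is blocking if every subposition that is a Left end is a blocked Left end and every subposition that is a Right end is a blocked Right end. $\mathcal{B}$ is the set of all blocking games. *)

theory Defs
  imports "HOL-Library.FSet"
begin

datatype game = Game (left_opts: "game fset") (right_opts: "game fset")

lemma size_left_opt [termination_simp]: "G |\<in>| L \<Longrightarrow> size G < size (Game L R)"
proof -
  assume "G |\<in>| L"
  then have "Suc (size G) \<le> (\<Sum>x\<in>fset L. Suc (size x))"
    by (intro member_le_sum) auto
  then show ?thesis by simp
qed

lemma size_right_opt [termination_simp]: "G |\<in>| R \<Longrightarrow> size G < size (Game L R)"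
proof -
  assume "G |\<in>| R"
  then have "Suc (size G) \<le> (\<Sum>x\<in>fset R. Suc (size x))"
    by (intro member_le_sum) auto
  then show ?thesis by simp
qed

definition left_end :: "game \<Rightarrow> bool" where
  "left_end G \<longleftrightarrow> left_opts G = {||}"

definition right_end :: "game \<Rightarrow> bool" where
  "right_end G \<longleftrightarrow> right_opts G = {||}"

function game_sum :: "game \<Rightarrow> game \<Rightarrow> game" where
  "game_sum (Game L1 R1) (Game L2 R2) =
     Game ((\<lambda>G. game_sum G (Game L2 R2)) |`| L1 |\<union>| (\<lambda>H. game_sum (Game L1 R1) H) |`| L2)
          ((\<lambda>G. game_sum G (Game L2 R2)) |`| R1 |\<union>| (\<lambda>H. game_sum (Game L1 R1) H) |`| R2)"
  by pat_completeness auto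
termination
  by (relation "measure (\<lambda>(G, H). size G + size H)")
     (simp_all add: size_left_opt size_right_opt del: game.size)

instantiation game :: plus
begin
definition plus_game :: "game \<Rightarrow> game \<Rightarrow> game" where
  "plus_game = game_sum"
instance ..
end

text \<open>Misere play: a player who has to move but has no option wins.
  There are no draws, so a player wins moving second iff the opponent does not win moving first.\<close>

function left_wins_first :: "game \<Rightarrow> bool"
  and right_wins_first :: "game \<Rightarrow> bool" where
  "left_wins_first (Game L R) \<longleftrightarrow> L = {||} \<or> (\<exists>G |\<in>| L. \<not> right_wins_first G)"
| "right_wins_first (Game L R) \<longleftrightarrow> R = {||} \<or> (\<exists>G |\<in>| R. \<not> left_wins_first G)"
  by pat_completeness auto
termination
  by (relation "measure (case_sum size size)")
     (simp_all add: size_left_opt size_right_opt del: game.size)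

datatype outcome = Outcome_L | Outcome_N | Outcome_P | Outcome_R

instantiation outcome :: order
begin

definition less_eq_outcome :: "outcome \<Rightarrow> outcome \<Rightarrow> bool" where
  "less_eq_outcome a b \<longleftrightarrow> a = b \<or> a = Outcome_R \<or> b = Outcome_L"

definition less_outcome :: "outcome \<Rightarrow> outcome \<Rightarrow> bool" where
  "less_outcome a b \<longleftrightarrow> a \<le> b \<and> \<not> b \<le> a" for a b :: outcome

instance
  by standard (auto simp: less_eq_outcome_def less_outcome_def)

end

definition game_outcome :: "game \<Rightarrow> outcome" where
  "game_outcome G =
     (if left_wins_first G
      then if right_wins_first G then Outcome_N else Outcome_L
      else if right_wins_first G then Outcome_R else Outcome_P)"

inductive subposition :: "game \<Rightarrow> game \<Rightarrow> bool" where
  refl: "subposition G G"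
| left: "subposition H G \<Longrightarrow> K |\<in>| left_opts H \<Longrightarrow> subposition K G"
| right: "subposition H G \<Longrightarrow> K |\<in>| right_opts H \<Longrightarrow> subposition K G"

definition strictly_P_free :: "game \<Rightarrow> bool" where
  "strictly_P_free G \<longleftrightarrow> (\<forall>H. subposition H G \<longrightarrow> game_outcome H \<noteq> Outcome_P)"

definition game_ge :: "game set \<Rightarrow> game \<Rightarrow> game \<Rightarrow> bool" where
  "game_ge A G H \<longleftrightarrow> (\<forall>X\<in>A. game_outcome (G + X) \<ge> game_outcome (H + X))"

definition game_equiv :: "game set \<Rightarrow> game \<Rightarrow> game \<Rightarrow> bool" where
  "game_equiv A G H \<longleftrightarrow> game_ge A G H \<and> game_ge A H G"

definition strictly_P_free_part :: "game set \<Rightarrow> game set" where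
  "strictly_P_free_part A = {G \<in> A. strictly_P_free G}"

definition P_free_mod_part :: "game set \<Rightarrow> game set" where
  "P_free_mod_part A = {G \<in> A. \<exists>H\<in>A. strictly_P_free H \<and> game_equiv A G H}"

inductive blocked_left_end :: "game \<Rightarrow> bool" where
  "left_end X \<Longrightarrow>
   (\<And>XR. XR |\<in>| right_opts X \<Longrightarrow>
      blocked_left_end XR \<or> (\<exists>XRL. XRL |\<in>| left_opts XR \<and> blocked_left_end XRL)) \<Longrightarrow>
   blocked_left_end X"

inductive blocked_right_end :: "game \<Rightarrow> bool" where
  "right_end X \<Longrightarrow>
   (\<And>XL. XL |\<in>| left_opts X \<Longrightarrow>
      blocked_right_end XL \<or> (\<exists>XLR. XLR |\<in>| right_opts XL \<and> blocked_right_end XLR)) \<Longrightarrow>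
   blocked_right_end X"

definition blocking :: "game \<Rightarrow> bool" where
  "blocking G \<longleftrightarrow>
     (\<forall>H. subposition H G \<longrightarrow>
        (left_end H \<longrightarrow> blocked_left_end H) \<and> (right_end H \<longrightarrow> blocked_right_end H))"

definition blocking_games :: "game set" where
  "blocking_games = {G. blocking G}"

end

theory Submission
  imports Defs
begin

text \<open>Call a game winning for a player if that player wins it whoever starts. Among strictly
  \<open>\<P>\<close>-free blocking games, sums of games winning for Left are winning for Left: she answers in
  the component where Right moved, and if this component has become a Left end, she makes a
  winning move elsewhere, while the blocked end does her no harm.

  Suppose that \<open>G + H\<close> is a \<open>\<P>\<close>-position of minimal size, and consider the infinite sum
  \<open>H + G + H + G + \<dots>\<close>. Any two neighbouring components form a copy of \<open>G + H\<close>; let Right and Left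
  play a winning strategy as second player in alternate copies. A reply in one copy is a first move
  in the next or the previous copy and thus triggers a reply there, so a single move of Left in the
  first component starts a play which turns out never to get stuck. Each component admits only
  finitely many moves, so the play reaches arbitrarily many components. Then two of them become the
  same subposition of \<open>H\<close>, and the components between these form a sum that splits into pairs
  winning for Left, but also into pairs winning for Right, which is absurd.\<close>

section \<open>The monoid of games\<close>

instantiation game :: zero
begin
definition zero_game :: game where
  "zero_game = Game {||} {||}"
instance ..
end

text \<open>The Boolean stands for a player: \<open>True\<close> for Left, \<open>False\<close> for Right.\<close>

definition moves :: "bool \<Rightarrow> game \<Rightarrow> game fset" where
  "moves p G = (if p then left_opts G else right_opts G)"

definition wins_first :: "bool \<Rightarrow> game \<Rightarrow> bool" where
  "wins_first p G = (if p then left_wins_first G else right_wins_first G)"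

definition blocked_end :: "bool \<Rightarrow> game \<Rightarrow> bool" where
  "blocked_end p G = (if p then blocked_left_end G else blocked_right_end G)"

lemma size_moves: "G' |\<in>| moves p G \<Longrightarrow> size G' < size G"
  by (cases G) (auto simp: moves_def size_left_opt size_right_opt simp del: game.size split: if_splits)

lemma moves_plus:
  "moves p (G + H) = (\<lambda>G'. G' + H) |`| moves p G |\<union>| (\<lambda>H'. G + H') |`| moves p H"
  by (cases G; cases H) (simp add: moves_def plus_game_def)

lemma moves_plusE:
  assumes "K |\<in>| moves p (G + H)"
  obtains G' where "G' |\<in>| moves p G" "K = G' + H"
    | H' where "H' |\<in>| moves p H" "K = G + H'"
  using assms by (auto simp: moves_plus)

lemma moves_plus_left: "G' |\<in>| moves p G \<Longrightarrow> G' + H |\<in>| moves p (G + H)"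
  and moves_plus_right: "H' |\<in>| moves p H \<Longrightarrow> G + H' |\<in>| moves p (G + H)"
  by (auto simp: moves_plus)

lemma moves_plus_empty: "moves p (G + H) = {||} \<longleftrightarrow> moves p G = {||} \<and> moves p H = {||}"
  by (auto simp: moves_plus)

lemma game_eqI: "(\<And>p. moves p G = moves p H) \<Longrightarrow> G = H"
  by (metis game.expand moves_def)

text \<open>This provides finite sums of games, which \<open>line_bound\<close> regroups in two
  ways.\<close>

instance game :: comm_monoid_add
proof
  fix G H K :: game
  show "G + H + K = G + (H + K)"
  proof (induction "size G + size H + size K" arbitrary: G H K rule: less_induct)
    case less
    show ?case
    proof (rule game_eqI)
      fix p
      have "(\<lambda>X. X + H + K) |`| moves p G = (\<lambda>X. X + (H + K)) |`| moves p G"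
        by (intro fset.map_cong refl less) (auto dest: size_moves)
      moreover have "(\<lambda>X. G + X + K) |`| moves p H = (\<lambda>X. G + (X + K)) |`| moves p H"
        by (intro fset.map_cong refl less) (auto dest: size_moves)
      moreover have "(\<lambda>X. G + H + X) |`| moves p K = (\<lambda>X. G + (H + X)) |`| moves p K"
        by (intro fset.map_cong refl less) (auto dest: size_moves)
      ultimately show "moves p (G + H + K) = moves p (G + (H + K))"
        by (simp add: moves_plus fimage_funion fset.map_comp comp_def sup_assoc)
    qed
  qed
  show "G + H = H + G"
  proof (induction "size G + size H" arbitrary: G H rule: less_induct)
    case less
    show ?case
    proof (rule game_eqI)
      fix p
      have "(\<lambda>X. X + H) |`| moves p G = (\<lambda>X. H + X) |`| moves p G"
        by (intro fset.map_cong refl less) (auto dest: size_moves)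
      moreover have "(\<lambda>X. G + X) |`| moves p H = (\<lambda>X. X + G) |`| moves p H"
        by (intro fset.map_cong refl less) (auto dest: size_moves)
      ultimately show "moves p (G + H) = moves p (H + G)"
        by (simp add: moves_plus sup_commute)
    qed
  qed
  show "0 + G = G"
  proof (induction "size G" arbitrary: G rule: less_induct)
    case less
    show ?case
    proof (rule game_eqI)
      fix p
      have "(\<lambda>X. 0 + X) |`| moves p G = (\<lambda>X. X) |`| moves p G"
        by (intro fset.map_cong refl less) (auto dest: size_moves)
      then show "moves p (0 + G) = moves p G"
        unfolding moves_plus by (simp add: zero_game_def moves_def)
    qed
  qed
qed


section \<open>Outcomes, subpositions and blocked ends\<close>

lemma wins_first_iff:
  "wins_first p G \<longleftrightarrow> moves p G = {||} \<or> (\<exists>G'. G' |\<in>| moves p G \<and> \<not> wins_first (\<not> p) G')"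
  by (cases G) (auto simp: wins_first_def moves_def)

lemma game_outcome_P_iff: "game_outcome G = Outcome_P \<longleftrightarrow> (\<forall>p. \<not> wins_first p G)"
  by (auto simp: game_outcome_def wins_first_def all_bool_eq)

lemma subposition_moves: "subposition H G \<Longrightarrow> K |\<in>| moves p H \<Longrightarrow> subposition K G"
  by (cases p) (auto simp: moves_def intro: subposition.intros)

lemma subposition_trans: "subposition K H \<Longrightarrow> subposition H G \<Longrightarrow> subposition K G"
  by (induction rule: subposition.induct) (auto intro: subposition.intros)

lemma subposition_cases:
  "subposition K G \<Longrightarrow> K = G \<or> (\<exists>p G'. G' |\<in>| moves p G \<and> subposition K G')"
proof (induction rule: subposition.induct)
  case (left H G K)
  then show ?case
    by (metis moves_def subposition.left subposition.refl)
next
  case (right H G K)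
  then show ?case
    by (metis moves_def subposition.right subposition.refl)
qed simp

lemma finite_subpositions: "finite {K. subposition K G}"
proof (induction "size G" arbitrary: G rule: less_induct)
  case less
  have "{K. subposition K G} \<subseteq> insert G (\<Union>p. \<Union>G' \<in> fset (moves p G). {K. subposition K G'})"
    by (auto dest!: subposition_cases[of _ G])
  moreover have "finite \<dots>"
    using less[OF size_moves] by simp
  ultimately show ?case
    by (rule finite_subset)
qed

lemma subposition_plusE:
  assumes "subposition K (G + H)"
  obtains G' H' where "K = G' + H'" "subposition G' G" "subposition H' H"
proof -
  have "\<exists>G' H'. K = G' + H' \<and> subposition G' G \<and> subposition H' H"
    using assms
  proof (induction K "G + H" rule: subposition.induct)
    case refl
    then show ?case by (blast intro: subposition.refl)
  next
    case (left K K')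
    then obtain G' H' where "K = G' + H'" "subposition G' G" "subposition H' H" by blast
    moreover have "K' |\<in>| moves True K" using left by (simp add: moves_def)
    ultimately show ?case by (auto elim!: moves_plusE intro: subposition_moves)
  next
    case (right K K')
    then obtain G' H' where "K = G' + H'" "subposition G' G" "subposition H' H" by blast
    moreover have "K' |\<in>| moves False K" using right by (simp add: moves_def)
    ultimately show ?case by (auto elim!: moves_plusE intro: subposition_moves)
  qed
  then show thesis using that by blast
qed

lemma blocked_end_iff:
  "blocked_end p X \<longleftrightarrow> moves p X = {||} \<and>
     (\<forall>Y. Y |\<in>| moves (\<not> p) X \<longrightarrow>
        blocked_end p Y \<or> (\<exists>Z. Z |\<in>| moves p Y \<and> blocked_end p Z))"
  using blocked_left_end.simps[of X] blocked_right_end.simps[of X]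
  by (cases p) (simp_all add: blocked_end_def moves_def left_end_def right_end_def)

text \<open>A move of the opponent in one summand is repaired within that summand, so the other
  stays blocked.\<close>

lemma blocked_end_plus:
  assumes "blocked_end p X" "blocked_end p Y"
  shows "blocked_end p (X + Y)"
  using assms
proof (induction "size X + size Y" arbitrary: X Y rule: less_induct)
  case less
  note end_X = less.prems(1)[unfolded blocked_end_iff[of p X]]
  note end_Y = less.prems(2)[unfolded blocked_end_iff[of p Y]]
  have "blocked_end p K \<or> (\<exists>Z. Z |\<in>| moves p K \<and> blocked_end p Z)"
    if "K |\<in>| moves (\<not> p) (X + Y)" for K
    using that
  proof (cases rule: moves_plusE)
    case (1 X')
    from end_X 1 consider "blocked_end p X'" | Z where "Z |\<in>| moves p X'" "blocked_end p Z"
      by blast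
    then show ?thesis
    proof cases
      case a: 1
      then show ?thesis using 1 less size_moves by (metis add_less_cancel_right)
    next
      case a: 2
      then have "blocked_end p (Z + Y)"
        using 1 less size_moves by (meson add_less_cancel_right less_trans)
      then show ?thesis using a 1 moves_plus_left by blast
    qed
  next
    case (2 Y')
    from end_Y 2 consider "blocked_end p Y'" | Z where "Z |\<in>| moves p Y'" "blocked_end p Z"
      by blast
    then show ?thesis
    proof cases
      case a: 1
      then show ?thesis using 2 less size_moves by (metis add_less_cancel_left)
    next
      case a: 2
      then have "blocked_end p (X + Z)"
        using 2 less size_moves by (meson add_less_cancel_left less_trans)
      then show ?thesis using a 2 moves_plus_right by blast
    qed
  qed
  then show ?case
    using end_X end_Y by (simp add: blocked_end_iff[of p "X + Y"] moves_plus_empty)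
qed

lemma blocking_iff:
  "blocking G \<longleftrightarrow> (\<forall>H p. subposition H G \<longrightarrow> moves p H = {||} \<longrightarrow> blocked_end p H)"
  by (auto simp: blocking_def moves_def blocked_end_def left_end_def right_end_def all_bool_eq)

lemma blocking_plus: "blocking G \<Longrightarrow> blocking H \<Longrightarrow> blocking (G + H)"
  unfolding blocking_iff
  by (intro allI impI, erule subposition_plusE) (auto simp: moves_plus_empty intro: blocked_end_plus)

definition P_free_blocking :: "game \<Rightarrow> bool" where
  "P_free_blocking G \<longleftrightarrow> blocking G \<and> strictly_P_free G"

lemma P_free_blocking_subposition:
  "P_free_blocking G \<Longrightarrow> subposition H G \<Longrightarrow> P_free_blocking H"
  unfolding P_free_blocking_def blocking_def strictly_P_free_def
  by (meson subposition_trans)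

lemma P_free_blocking_moves: "P_free_blocking G \<Longrightarrow> H |\<in>| moves p G \<Longrightarrow> P_free_blocking H"
  by (meson P_free_blocking_subposition subposition_moves subposition.refl)

lemma P_free_blocking_end: "P_free_blocking G \<Longrightarrow> moves p G = {||} \<Longrightarrow> blocked_end p G"
  by (auto simp: P_free_blocking_def blocking_iff intro: subposition.refl)

lemma P_free_blocking_wins_first:
  assumes "P_free_blocking G" "\<not> wins_first (\<not> p) G"
  shows "wins_first p G"
proof -
  have "\<exists>q. wins_first q G"
    using assms(1) subposition.refl[of G]
    by (auto simp: P_free_blocking_def strictly_P_free_def game_outcome_P_iff)
  then show ?thesis
    using assms(2) by (cases p) (auto simp: ex_bool_eq)
qed


section \<open>Games won by a player regardless of who starts\<close>

text \<open>On blocking games without \<open>\<P>\<close>-positions, \<open>advantage p G\<close> says that \<open>p\<close> wins \<open>G\<close> moving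
  first or second. Unlike that condition, it is visibly preserved by sums, with no assumption on
  the outcomes of the sums: whenever the opponent's move leaves \<open>p\<close> without a reply in one
  component, that component is blocked and \<open>p\<close> has a good move in another one.\<close>

inductive advantage :: "bool \<Rightarrow> game \<Rightarrow> bool" for p where
  "moves (\<not> p) G \<noteq> {||} \<Longrightarrow>
   blocked_end p G \<or> (\<exists>G'. G' |\<in>| moves p G \<and> advantage p G') \<Longrightarrow>
   (\<And>G'. G' |\<in>| moves (\<not> p) G \<Longrightarrow>
      blocked_end p G' \<or> (\<exists>G''. G'' |\<in>| moves p G' \<and> advantage p G'')) \<Longrightarrow>
   advantage p G"

lemma advantage_iff:
  "advantage p G \<longleftrightarrow> moves (\<not> p) G \<noteq> {||} \<and>
     (blocked_end p G \<or> (\<exists>G'. G' |\<in>| moves p G \<and> advantage p G')) \<and>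
     (\<forall>G'. G' |\<in>| moves (\<not> p) G \<longrightarrow>
        blocked_end p G' \<or> (\<exists>G''. G'' |\<in>| moves p G' \<and> advantage p G''))"
  by (subst advantage.simps) blast

lemma advantage_not_wins_first: "advantage p G \<Longrightarrow> \<not> wins_first (\<not> p) G"
proof (induction rule: advantage.induct)
  case (1 G)
  have "wins_first p G'" if "G' |\<in>| moves (\<not> p) G" for G'
    using 1(3)[OF that] blocked_end_iff[of p G'] wins_first_iff[of p G'] by blast
  then show ?case
    using 1(1) by (simp add: wins_first_iff[of "\<not> p" G])
qed

lemma advantage_wins_first: "advantage p G \<Longrightarrow> wins_first p G"
  using advantage_iff[of p G] advantage_not_wins_first[of p] blocked_end_iff[of p G]
    wins_first_iff[of p G]
  by blast

text \<open>Without P-positions, \<open>p\<close> wins moving first as well as second; blocking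
  turns each position where \<open>p\<close> is stuck into a blocked end.\<close>

lemma advantageI:
  assumes "P_free_blocking G" "\<not> wins_first (\<not> p) G"
  shows "advantage p G"
  using assms
proof (induction "size G" arbitrary: G rule: less_induct)
  case less
  have reply: "blocked_end p K \<or> (\<exists>K'. K' |\<in>| moves p K \<and> advantage p K')"
    if "P_free_blocking K" "wins_first p K" "size K \<le> size G" for K
  proof (cases "moves p K = {||}")
    case True
    then show ?thesis using that P_free_blocking_end by blast
  next
    case False
    then obtain K' where "K' |\<in>| moves p K" "\<not> wins_first (\<not> p) K'"
      using \<open>wins_first p K\<close> wins_first_iff by blast
    then show ?thesis
      using less.hyps that P_free_blocking_moves size_moves by (meson less_le_trans)
  qed
  show ?case
    unfolding advantage_iff[of p G]
  proof (intro conjI allI impI)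
    show "moves (\<not> p) G \<noteq> {||}"
      using less.prems wins_first_iff by blast
    show "blocked_end p G \<or> (\<exists>G'. G' |\<in>| moves p G \<and> advantage p G')"
      using reply less.prems P_free_blocking_wins_first by blast
    show "blocked_end p G' \<or> (\<exists>G''. G'' |\<in>| moves p G' \<and> advantage p G'')"
      if "G' |\<in>| moves (\<not> p) G" for G'
      using reply[of G'] that less.prems(2) P_free_blocking_moves[OF less.prems(1) that]
        size_moves[OF that] wins_first_iff[of "\<not> p" G]
      by auto
  qed
qed

text \<open>When \<open>p\<close> must move and the first component is blocked, either
  \<open>W\<close> is blocked too or \<open>p\<close> moves in \<open>W\<close> and keeps the
  advantage there.\<close>

lemma blocked_end_plus_advantage:
  assumes "blocked_end p X" "advantage p W"
  shows "advantage p (X + W)"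
  using assms
proof (induction "size X + size W" arbitrary: X W rule: less_induct)
  case less
  note end_X = less.prems(1)[unfolded blocked_end_iff[of p X]]
  note adv_W = less.prems(2)[unfolded advantage_iff[of p W]]
  show ?case
    unfolding advantage_iff[of p "X + W"]
  proof (intro conjI allI impI)
    show "moves (\<not> p) (X + W) \<noteq> {||}"
      using adv_W by (simp add: moves_plus_empty)
    have *: "blocked_end p (X' + W) \<or> (\<exists>K. K |\<in>| moves p (X' + W) \<and> advantage p K)"
      if "blocked_end p X'" "size X' \<le> size X" for X'
    proof (cases "blocked_end p W")
      case True
      then show ?thesis using that blocked_end_plus by blast
    next
      case False
      then obtain W' where "W' |\<in>| moves p W" "advantage p W'"
        using adv_W by blast
      then show ?thesis
        using less.hyps[of X' W'] that size_moves[of W' p W] moves_plus_right by fastforce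
    qed
    show "blocked_end p (X + W) \<or> (\<exists>K. K |\<in>| moves p (X + W) \<and> advantage p K)"
      using * less.prems by simp
    fix K assume "K |\<in>| moves (\<not> p) (X + W)"
    then show "blocked_end p K \<or> (\<exists>K'. K' |\<in>| moves p K \<and> advantage p K')"
    proof (cases rule: moves_plusE)
      case (1 X')
      from end_X 1 consider "blocked_end p X'" | Z where "Z |\<in>| moves p X'" "blocked_end p Z"
        by blast
      then show ?thesis
      proof cases
        case a: 1
        then show ?thesis using 1 * size_moves by (simp add: less_imp_le)
      next
        case a: 2
        then have "advantage p (Z + W)"
          using 1 less size_moves by (meson add_less_cancel_right less_trans)
        then show ?thesis using a 1 moves_plus_left by blast
      qed
    next
      case (2 W')
      from adv_W 2 consider "blocked_end p W'" | Z where "Z |\<in>| moves p W'" "advantage p Z"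
        by blast
      then show ?thesis
      proof cases
        case a: 1
        then show ?thesis using 2 less.prems blocked_end_plus by blast
      next
        case a: 2
        then have "advantage p (X + Z)"
          using 2 less size_moves by (meson add_less_cancel_left less_trans)
        then show ?thesis using a 2 moves_plus_right by blast
      qed
    qed
  qed
qed

lemma advantage_plus:
  assumes "advantage p G" "advantage p H"
  shows "advantage p (G + H)"
  using assms
proof (induction "size G + size H" arbitrary: G H rule: less_induct)
  case less
  \<comment> \<open>\<open>G'\<close> is the component in which the opponent just moved, or
    \<open>G\<close> itself if \<open>p\<close> starts; if it is blocked, \<open>p\<close> turns to
    \<open>H'\<close>.\<close>
  have reply: "blocked_end p (G' + H') \<or> (\<exists>K. K |\<in>| moves p (G' + H') \<and> advantage p K)"
    if "blocked_end p G' \<or> (\<exists>G''. G'' |\<in>| moves p G' \<and> advantage p G'')" "advantage p H'"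
      "size G' + size H' \<le> size G + size H" for G' H'
  proof (cases "\<exists>G''. G'' |\<in>| moves p G' \<and> advantage p G''")
    case True
    then obtain G'' where "G'' |\<in>| moves p G'" "advantage p G''" by blast
    then show ?thesis
      using less.hyps[of G'' H'] that size_moves[of G'' p G'] moves_plus_left by fastforce
  next
    case False
    then have G': "blocked_end p G'" using that by blast
    consider "blocked_end p H'" | H'' where "H'' |\<in>| moves p H'" "advantage p H''"
      using \<open>advantage p H'\<close> advantage_iff by blast
    then show ?thesis
      using G' blocked_end_plus blocked_end_plus_advantage moves_plus_right by cases blast+
  qed
  show ?case
    unfolding advantage_iff[of p "G + H"]
  proof (intro conjI allI impI)
    show "moves (\<not> p) (G + H) \<noteq> {||}"
      using less.prems advantage_iff moves_plus_empty by blast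
    show "blocked_end p (G + H) \<or> (\<exists>K. K |\<in>| moves p (G + H) \<and> advantage p K)"
      using reply[of G H] less.prems advantage_iff by blast
    fix K assume "K |\<in>| moves (\<not> p) (G + H)"
    then show "blocked_end p K \<or> (\<exists>K'. K' |\<in>| moves p K \<and> advantage p K')"
    proof (cases rule: moves_plusE)
      case (1 G')
      then show ?thesis
        using reply[of G' H] less.prems advantage_iff[of p G] size_moves[of G' "\<not> p" G] by simp
    next
      case (2 H')
      then show ?thesis
        using reply[of H' G] less.prems advantage_iff[of p H] size_moves[of H' "\<not> p" H]
        by (simp add: add.commute)
    qed
  qed
qed

lemma advantage_sum:
  assumes "finite A" "A \<noteq> {}" "\<And>x. x \<in> A \<Longrightarrow> advantage p (f x)"
  shows "advantage p (sum f A)"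
  using assms by (induction A rule: finite_ne_induct) (auto intro: advantage_plus)

text \<open>Read contrapositively, this and the next lemma pass a failure to win moving first from a
  sum to its second component, as \<open>line_reply\<close> requires.\<close>

lemma blocked_end_plus_wins_first:
  assumes "blocked_end p X" "P_free_blocking Z" "wins_first p Z"
  shows "wins_first p (X + Z)"
proof (cases "moves p Z = {||}")
  case True
  then show ?thesis
    using assms(1) by (simp add: wins_first_iff[of p "X + Z"] moves_plus_empty blocked_end_iff[of p X])
next
  case False
  then obtain Z' where "Z' |\<in>| moves p Z" "\<not> wins_first (\<not> p) Z'"
    using assms(3) wins_first_iff by blast
  then show ?thesis
    using assms advantageI P_free_blocking_moves blocked_end_plus_advantage
      advantage_not_wins_first moves_plus_right wins_first_iff by meson
qed

lemma advantage_plus_wins_first: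
  assumes "advantage p W" "P_free_blocking Z" "wins_first p Z"
  shows "wins_first p (W + Z)"
proof (cases "moves p Z = {||}")
  case True
  then show ?thesis
    using assms P_free_blocking_end blocked_end_plus_advantage advantage_wins_first
    by (metis add.commute)
next
  case False
  then obtain Z' where "Z' |\<in>| moves p Z" "\<not> wins_first (\<not> p) Z'"
    using assms(3) wins_first_iff by blast
  then show ?thesis
    using assms advantageI P_free_blocking_moves advantage_plus
      advantage_not_wins_first moves_plus_right wins_first_iff by meson
qed


section \<open>A minimal sum with outcome \<open>\<P>\<close>\<close>

lemma subposition_size: "subposition K G \<Longrightarrow> size K \<le> size G"
proof (induction rule: subposition.induct)
  case (left H G K)
  then show ?case using size_moves[of K True H] by (simp add: moves_def)
next
  case (right H G K)
  then show ?case using size_moves[of K False H] by (simp add: moves_def)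
qed simp

text \<open>The assumption \<open>not_opposite\<close> depends on the order of the summands; for
  strictly P-free games at least one of the two orders satisfies it.\<close>

locale minimal_P_sum =
  fixes G H :: game
  assumes G: "P_free_blocking G" and H: "P_free_blocking H"
    and P_position: "\<not> wins_first p (G + H)"
    and minimal: "subposition G' G \<Longrightarrow> subposition H' H \<Longrightarrow> size G' + size H' < size G + size H \<Longrightarrow>
      \<exists>p. wins_first p (G' + H')"
    and not_opposite: "wins_first True G \<or> wins_first False H"
begin

lemma P_free_blocking_smaller:
  assumes "subposition G' G" "subposition H' H" "size G' + size H' < size G + size H"
  shows "P_free_blocking (G' + H')"
  unfolding P_free_blocking_def strictly_P_free_def game_outcome_P_iff
proof (intro conjI allI impI)
  show "blocking (G' + H')"
    using assms G H P_free_blocking_subposition blocking_plus unfolding P_free_blocking_def by blast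
  fix K assume "subposition K (G' + H')"
  then obtain G'' H'' where "K = G'' + H''" "subposition G'' G'" "subposition H'' H'"
    by (rule subposition_plusE)
  moreover from this have "size G'' + size H'' < size G + size H"
    using subposition_size assms(3) by (meson add_le_mono le_less_trans)
  ultimately show "\<not> (\<forall>p. \<not> wins_first p K)"
    using minimal assms by (meson subposition_trans)
qed

definition start :: "nat \<Rightarrow> game" where
  "start k = (if odd k then H else G)"

text \<open>The two players move alternately in the infinite sum of \<open>H, G, H, G, \<dots>\<close>, indexed
  from 1. The neighbours \<open>s k\<close> and \<open>s (k + 1)\<close> form a copy of \<open>G + H\<close>, in which one player,
  Left for even \<open>k\<close> and Right for odd \<open>k\<close>, follows a winning strategy as second player. A
  reply made in \<open>s k\<close> or \<open>s (k + 1)\<close> is a first move in the adjacent pair, to be answered by the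
  other player there. In \<open>line s q m\<close>, the pair \<open>q\<close> awaits an answer; for \<open>q = 0\<close> instead, Left
  may move freely in \<open>s 1\<close>. The components beyond \<open>m\<close> are untouched.\<close>

definition line :: "(nat \<Rightarrow> game) \<Rightarrow> nat \<Rightarrow> nat \<Rightarrow> bool" where
  "line s q m \<longleftrightarrow>
     (\<forall>k. subposition (s k) (start k)) \<and>
     (\<forall>k\<ge>1. k \<noteq> q \<longrightarrow> \<not> wins_first (odd k) (s k + s (Suc k))) \<and>
     (q \<ge> 1 \<longrightarrow> wins_first (even q) (s q + s (Suc q))) \<and>
     (\<forall>k>m. s k = start k) \<and>
     (\<forall>k\<ge>1. k \<le> m \<longrightarrow> size (s k) < size (start k)) \<and>
     q \<le> m"

lemma P_free_blocking_start: "subposition X (start k) \<Longrightarrow> P_free_blocking X"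
  using G H P_free_blocking_subposition by (auto simp: start_def split: if_splits)

text \<open>A touched component makes the pair smaller than \<open>G + H\<close>, so minimality
  applies.\<close>

lemma P_free_blocking_pair:
  assumes "\<And>k. subposition (s k) (start k)" "size (s k) < size (start k)"
  shows "P_free_blocking (s k + s (Suc k))"
proof -
  have sub: "subposition (s k) (start k)" "subposition (s (Suc k)) (start (Suc k))"
    using assms by blast+
  have "size (s k) + size (s (Suc k)) < size (start k) + size (start (Suc k))"
    using assms(2) subposition_size[OF sub(2)] by linarith
  then show ?thesis
    using sub P_free_blocking_smaller[of "s k" "s (Suc k)"]
      P_free_blocking_smaller[of "s (Suc k)" "s k"]
    by (auto simp: start_def add.commute split: if_splits)
qed

text \<open>A missing reply would propagate along the line and force \<open>G\<close> to be won by Right and \<open>H\<close> by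
  Left, whoever starts.\<close>

lemma line_reply:
  assumes sub: "\<And>k. subposition (s k) (start k)"
    and rest: "\<And>k. k > q \<Longrightarrow> \<not> wins_first (odd k) (s k + s (Suc k))"
    and untouched: "\<And>k. k > m \<Longrightarrow> s k = start k"
  shows "moves (even q) (s (Suc q)) \<noteq> {||}"
proof
  assume "moves (even q) (s (Suc q)) = {||}"
  then have "blocked_end (even q) (s (Suc q))"
    using P_free_blocking_end P_free_blocking_start sub by blast
  moreover have "\<not> wins_first (even q) (s (Suc q) + s (Suc (Suc q)))"
    using rest[of "Suc q"] by simp
  ultimately have base: "\<not> wins_first (even q) (s (Suc (Suc q)))"
    using blocked_end_plus_wins_first P_free_blocking_start sub by blast
  \<comment> \<open>If the player \<open>odd j\<close> has the advantage in \<open>s j\<close> but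
    cannot win the pair \<open>j\<close> moving first, that player cannot win
    \<open>s (Suc j)\<close> moving first either.\<close>
  have tail: "\<not> wins_first (even j) (s j)" if "j \<ge> Suc (Suc q)" for j
    using that
  proof (induction j rule: dec_induct)
    case base
    then show ?case using \<open>\<not> wins_first (even q) (s (Suc (Suc q)))\<close> by simp
  next
    case (step j)
    then have "advantage (odd j) (s j)"
      using advantageI[of "s j" "odd j"] P_free_blocking_start[OF sub] by simp
    then show ?case
      using rest[of j] step.hyps P_free_blocking_start[OF sub, of "Suc j"]
        advantage_plus_wins_first[of "odd j" "s j" "s (Suc j)"]
      by auto
  qed
  \<comment> \<open>An even index beyond \<open>q\<close> and \<open>m\<close>, so
    \<open>s j\<close> is \<open>G\<close> and \<open>s (Suc j)\<close> is \<open>H\<close>.\<close>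
  define j where "j = 2 * (q + m + 1)"
  have "\<not> wins_first True G"
    using tail[of j] untouched[of j] by (simp add: j_def start_def)
  moreover have "\<not> wins_first False H"
    using tail[of "Suc j"] untouched[of "Suc j"] by (simp add: j_def start_def)
  ultimately show False
    using not_opposite by blast
qed

text \<open>If two components of the same parity coincide, then the pairs between them, grouped in the two
  possible ways, show that one and the same sum is won by each of the players.\<close>

lemma line_bound:
  assumes sub: "\<And>k. subposition (s k) (start k)"
    and rest: "\<And>k. 1 \<le> k \<Longrightarrow> k < m \<Longrightarrow> \<not> wins_first (odd k) (s k + s (Suc k))"
    and touched: "\<And>k. 1 \<le> k \<Longrightarrow> k < m \<Longrightarrow> size (s k) < size (start k)"
  shows "m \<le> 2 * card {K. subposition K H}"
proof (rule ccontr)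
  define N where "N = card {K. subposition K H}"
  assume "\<not> m \<le> 2 * card {K. subposition K H}"
  \<comment> \<open>The last pair used below has index \<open>2 * l'\<close>, which is at most
    \<open>2 * N\<close> and thus below \<open>m\<close>.\<close>
  then have m: "2 * N + 1 \<le> m" by (simp add: N_def)
  have adv: "advantage (even k) (s k + s (Suc k))" if "1 \<le> k" "k < m" for k
    using advantageI[of "s k + s (Suc k)" "even k"] P_free_blocking_pair[OF sub] rest touched that
    by simp
  \<comment> \<open>Pigeonhole: \<open>N + 1\<close> components at odd indices, but only
    \<open>N\<close> subpositions of \<open>H\<close>.\<close>
  have "(\<lambda>l. s (2 * l + 1)) ` {..N} \<subseteq> {K. subposition K H}"
    using sub[of "2 * _ + 1"] by (auto simp: start_def)
  then have "card ((\<lambda>l. s (2 * l + 1)) ` {..N}) \<le> N"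
    unfolding N_def by (intro card_mono finite_subpositions)
  then have "\<not> inj_on (\<lambda>l. s (2 * l + 1)) {..N}"
    using card_image by fastforce
  then obtain l l' where l: "l < l'" "l' \<le> N" "s (2 * l + 1) = s (2 * l' + 1)"
    unfolding inj_on_def by (metis atMost_iff linorder_neqE_nat)
  define u where "u x = s (2 * (l + x) + 1)" for x
  define v where "v x = s (2 * (l + x) + 2)" for x
  obtain n where n: "l' = l + Suc n"
    using l(1) less_iff_Suc_add by auto
  \<comment> \<open>As the two end components coincide, each \<open>v x\<close> may be paired with
    its left or its right neighbour without changing the total.\<close>
  have "(\<Sum>x<Suc n. u x) = u 0 + (\<Sum>x<n. u (Suc x))"
    by (rule sum.lessThan_Suc_shift)
  also have "u 0 = u (Suc n)"
    using l(3) n by (simp add: u_def)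
  also have "u (Suc n) + (\<Sum>x<n. u (Suc x)) = (\<Sum>x<Suc n. u (Suc x))"
    by (simp add: add.commute)
  finally have "(\<Sum>x<Suc n. u x + v x) = (\<Sum>x<Suc n. v x + u (Suc x))"
    by (simp only: sum.distrib add.commute)
  moreover have "advantage False (\<Sum>x<Suc n. u x + v x)"
  proof (rule advantage_sum)
    fix x assume "x \<in> {..<Suc n}"
    then show "advantage False (u x + v x)"
      using adv[of "2 * (l + x) + 1"] m l(2) n by (simp add: u_def v_def)
  qed auto
  moreover have "advantage True (\<Sum>x<Suc n. v x + u (Suc x))"
  proof (rule advantage_sum)
    fix x assume "x \<in> {..<Suc n}"
    then show "advantage True (v x + u (Suc x))"
      using adv[of "2 * (l + x) + 2"] m l(2) n by (simp add: u_def v_def)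
  qed auto
  ultimately show False
    using advantage_wins_first[of False] advantage_not_wins_first[of True] by fastforce
qed

text \<open>In misere play a win may come from having no move; \<open>line_reply\<close> excludes
  this, so the win in the pair \<open>q\<close> yields an actual move.\<close>

lemma line_move:
  assumes "line s q m"
  obtains r X where "r = q \<or> r = Suc q" "r \<ge> 1" "X |\<in>| moves (even q) (s r)"
    "q \<ge> 1 \<longrightarrow> \<not> wins_first (odd q) ((s(r := X)) q + (s(r := X)) (Suc q))"
proof -
  have nonempty: "moves (even q) (s (Suc q)) \<noteq> {||}"
    using assms by (intro line_reply[of s q m]) (auto simp: line_def)
  show thesis
  proof (cases "q = 0")
    case True
    then show ?thesis using nonempty that[of "Suc q"] by auto
  next
    case False
    then have "wins_first (even q) (s q + s (Suc q))"
      using assms by (simp add: line_def)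
    then obtain K where K: "K |\<in>| moves (even q) (s q + s (Suc q))" "\<not> wins_first (odd q) K"
      using nonempty wins_first_iff[of "even q" "s q + s (Suc q)"] by (auto simp: moves_plus_empty)
    from K(1) show ?thesis
    proof (cases rule: moves_plusE)
      case (1 X)
      then show ?thesis using that[of q X] K(2) False by simp
    next
      case (2 X)
      then show ?thesis using that[of "Suc q" X] K(2) by simp
    qed
  qed
qed

lemma line_step:
  assumes line: "line s q m" and r: "r = q \<or> r = Suc q" "r \<ge> 1"
    and X: "X |\<in>| moves (even q) (s r)"
    and answered: "q \<ge> 1 \<longrightarrow> \<not> wins_first (odd q) ((s(r := X)) q + (s(r := X)) (Suc q))"
  shows "line (s(r := X)) (if r = q then q - 1 else Suc q) (max m r)"
proof -
  define s' where "s' = s(r := X)"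
  define q' where "q' = (if r = q then q - 1 else Suc q)"
  have sub: "subposition (s k) (start k)" for k
    using line by (simp add: line_def)
  have rest: "\<not> wins_first (odd k) (s k + s (Suc k))" if "k \<ge> 1" "k \<noteq> q" for k
    using line that by (simp add: line_def)
  have q': "even q' \<longleftrightarrow> odd q" "q' \<noteq> q" "q' = r \<or> Suc q' = r"
    using r by (auto simp: q'_def)
  have "subposition (s' k) (start k)" for k
    using sub subposition_moves[OF sub X] by (simp add: s'_def)
  moreover have "\<not> wins_first (odd k) (s' k + s' (Suc k))" if "k \<ge> 1" "k \<noteq> q'" for k
  proof (cases "k = q")
    case True
    then show ?thesis using answered that by (simp add: s'_def)
  next
    case False
    then have "r \<noteq> k" "r \<noteq> Suc k"
      using that r by (auto simp: q'_def split: if_splits)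
    then show ?thesis using rest False that by (simp add: s'_def)
  qed
  moreover have "wins_first (even q') (s' q' + s' (Suc q'))" if "q' \<ge> 1"
  proof -
    \<comment> \<open>The reply is also a first move in the pair \<open>q'\<close>, where its player
      loses moving first.\<close>
    have "s' q' + s' (Suc q') |\<in>| moves (even q) (s q' + s (Suc q'))"
      using q'(3) X moves_plus_left moves_plus_right by (auto simp: s'_def)
    moreover have "\<not> wins_first (even q) (s q' + s (Suc q'))"
      using rest[of q'] q' that by simp
    ultimately show ?thesis
      using wins_first_iff[of "even q" "s q' + s (Suc q')"] q'(1) by auto
  qed
  moreover have "s' k = start k" if "k > max m r" for k
    using line that by (simp add: line_def s'_def)
  moreover have "size (s' k) < size (start k)" if "k \<ge> 1" "k \<le> max m r" for k
  proof (cases "k = r")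
    case True
    then show ?thesis
      using size_moves[OF X] subposition_size[OF sub[of r]] by (simp add: s'_def)
  next
    case False
    then have "k \<le> m"
      using that r line by (auto simp: line_def)
    then show ?thesis
      using line that False by (simp add: line_def s'_def)
  qed
  moreover have "q' \<le> max m r"
    using r line by (auto simp: q'_def line_def)
  ultimately show ?thesis
    unfolding line_def s'_def[symmetric] q'_def[symmetric] by blast
qed

text \<open>Every move shrinks the total size of an initial segment of components, which by
  \<open>line_bound\<close> the play never leaves.\<close>

lemma no_line:
  assumes "line s q m" "m \<le> 2 * card {K. subposition K H}"
  shows False
  using assms
proof (induction "\<Sum>k\<le>2 * card {K. subposition K H}. size (s k)" arbitrary: s q m rule: less_induct)
  case less
  define N where "N = card {K. subposition K H}"
  from line_move[OF less.prems(1)] obtain r X where r: "r = q \<or> r = Suc q" "r \<ge> 1"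
    and X: "X |\<in>| moves (even q) (s r)"
    and answered: "q \<ge> 1 \<longrightarrow> \<not> wins_first (odd q) ((s(r := X)) q + (s(r := X)) (Suc q))"
    by blast
  define q' where "q' = (if r = q then q - 1 else Suc q)"
  have line': "line (s(r := X)) q' (max m r)"
    unfolding q'_def using line_step less.prems(1) r X answered by blast
  have bound: "max m r \<le> 2 * N"
  proof (cases "r \<le> m")
    case True
    then show ?thesis using less.prems(2) by (simp add: N_def)
  next
    case False
    \<comment> \<open>When the play reaches a new component, the pair awaiting an answer lies at the
      frontier, so all earlier pairs satisfy \<open>line_bound\<close>.\<close>
    then have "q' = max m r"
      using r less.prems(1) by (auto simp: q'_def line_def)
    then show ?thesis
      unfolding N_def using line' by (intro line_bound[of "s(r := X)"]) (auto simp: line_def)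
  qed
  have "(\<Sum>k\<le>2 * N. size ((s(r := X)) k)) < (\<Sum>k\<le>2 * N. size (s k))"
    using bound size_moves[OF X] by (intro sum_strict_mono_ex1) auto
  then show False
    using less.hyps line' bound unfolding N_def by blast
qed

lemma contradiction: False
proof -
  have "line start 0 0"
    using P_position by (auto simp: line_def start_def add.commute[of H G] intro: subposition.refl)
  then show False
    using no_line by blast
qed

end

section \<open>Closure under sums, strictly and modulo equivalence\<close>

lemma P_free_blocking_plus_wins_first:
  assumes "P_free_blocking G" "P_free_blocking H"
  shows "\<exists>p. wins_first p (G + H)"
  using assms
proof (induction "size G + size H" arbitrary: G H rule: less_induct)
  case less
  show ?case
  proof (rule ccontr)
    assume "\<nexists>p. wins_first p (G + H)"
    then have P: "\<not> wins_first p (G + H)" for p by blast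
    have smaller: "\<exists>p. wins_first p (G' + H')"
      if "subposition G' G" "subposition H' H" "size G' + size H' < size G + size H" for G' H'
      using less.hyps[OF that(3)] less.prems that(1,2) P_free_blocking_subposition by blast
    show False
    proof (cases "wins_first True G \<or> wins_first False H")
      case True
      then have "minimal_P_sum G H"
        using less.prems P smaller by (simp add: minimal_P_sum_def)
      then show False by (rule minimal_P_sum.contradiction)
    next
      case False
      then have "wins_first True H \<or> wins_first False G"
        using P_free_blocking_wins_first[of G False] less.prems(1) by simp
      moreover have "\<exists>p. wins_first p (H' + G')"
        if "subposition H' H" "subposition G' G" "size H' + size G' < size H + size G" for H' G'
        using smaller[of G' H'] that by (simp add: add.commute)
      moreover have "\<not> wins_first p (H + G)" for p
        using P[of p] by (simp add: add.commute)
      ultimately have "minimal_P_sum H G"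
        using less.prems by (simp add: minimal_P_sum_def)
      then show False by (rule minimal_P_sum.contradiction)
    qed
  qed
qed

lemma P_free_blocking_plus:
  assumes "P_free_blocking G" "P_free_blocking H"
  shows "P_free_blocking (G + H)"
  unfolding P_free_blocking_def strictly_P_free_def game_outcome_P_iff
proof (intro conjI allI impI)
  show "blocking (G + H)"
    using assms by (simp add: P_free_blocking_def blocking_plus)
  fix K assume "subposition K (G + H)"
  then obtain G' H' where "K = G' + H'" "subposition G' G" "subposition H' H"
    by (rule subposition_plusE)
  then show "\<not> (\<forall>p. \<not> wins_first p K)"
    using assms P_free_blocking_plus_wins_first P_free_blocking_subposition by blast
qed

text \<open>The summands are replaced one at a time, the other one being absorbed into the test game
  by closure.\<close>

lemma game_equiv_plus:
  assumes closed: "\<And>X Y. X \<in> A \<Longrightarrow> Y \<in> A \<Longrightarrow> X + Y \<in> A"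
    and "H \<in> A" "G' \<in> A" "game_equiv A G G'" "game_equiv A H H'"
  shows "game_equiv A (G + H) (G' + H')"
proof -
  have "game_outcome (G + H + X) = game_outcome (G' + H' + X)" if "X \<in> A" for X
  proof -
    have "game_outcome (G + (H + X)) = game_outcome (G' + (H + X))"
      using assms that by (simp add: game_equiv_def game_ge_def order_antisym)
    moreover have "game_outcome (H + (G' + X)) = game_outcome (H' + (G' + X))"
      using assms that by (simp add: game_equiv_def game_ge_def order_antisym)
    ultimately show ?thesis
      by (simp add: ac_simps)
  qed
  then show ?thesis
    by (simp add: game_equiv_def game_ge_def)
qed

theorem theorem4p9:
  shows "(\<forall>G \<in> strictly_P_free_part blocking_games. \<forall>H \<in> strictly_P_free_part blocking_games.
            G + H \<in> strictly_P_free_part blocking_games) \<and>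
         (\<forall>G \<in> P_free_mod_part blocking_games. \<forall>H \<in> P_free_mod_part blocking_games.
            G + H \<in> P_free_mod_part blocking_games)"
proof (intro conjI ballI)
  fix G H
  assume "G \<in> strictly_P_free_part blocking_games" "H \<in> strictly_P_free_part blocking_games"
  then show "G + H \<in> strictly_P_free_part blocking_games"
    using P_free_blocking_plus
    by (simp add: strictly_P_free_part_def blocking_games_def P_free_blocking_def)
next
  fix G H
  assume "G \<in> P_free_mod_part blocking_games" "H \<in> P_free_mod_part blocking_games"
  then obtain G' H' where GH: "blocking G" "blocking H" "P_free_blocking G'" "P_free_blocking H'"
    "game_equiv blocking_games G G'" "game_equiv blocking_games H H'"
    by (auto simp: P_free_mod_part_def blocking_games_def P_free_blocking_def)
  then have "game_equiv blocking_games (G + H) (G' + H')"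
    by (intro game_equiv_plus) (auto simp: blocking_games_def blocking_plus P_free_blocking_def)
  moreover have "P_free_blocking (G' + H')"
    using GH P_free_blocking_plus by blast
  ultimately show "G + H \<in> P_free_mod_part blocking_games"
    using GH(1,2) blocking_plus
    unfolding P_free_mod_part_def P_free_blocking_def blocking_games_def by blast
qed

end
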